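(* For any graph $G$ as in the context and any chip configuration $D\ge 0$ on $G$, $D$ has exactly one $0$-stabilization.
   Context: Let $a,b,c$ be positive integers. Let $G$ be a simple undirected graph with vertex set $\{0\}\cup[n]$ ($0$ is the sink) such that $\{0,i\}$ is an edge for every $i\in[n]$. For $i\in[n]$ let $N(i)$ be the set of non-sink vertices adjacent to $i$ and $\deg(i)=|N(i)|$. A chip configuration is $D:[n]\to\mathbb{Z}$; $D\ge0$ means all values are nonnegative. The firing move $\phi_i$ sends $D$ to the configuration obtained by subtracting $c+\lfloor \deg(i)\,a/b\rfloor$ from $D(i)$ and adding $\lfloor a/b\rfloor$ to $D(j)$ for each $j\in N(i)$; it is legal on $D\ge0$ if $\phi_i(D)\ge 0$. A configuration $D\ge 0$ is $0$-stable if no $\phi_i$ is legal on it. A $0$-stabilization of $D\ge 0$ is a $0$-stable configuration obtained from $D$ by a finite sequence of single-vertex firing moves, each legal on the configuration to which it is applied. *)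

theory Defs
  imports Complex_Main "HOL-Library.FuncSet" "Graph_Theory.Pair_Digraph"
begin

text \<open>
  A simple undirected graph is a finite loop-free symmetric digraph without parallel arcs
  (locale \<^locale>\<open>pair_graph\<close>); the edge between \<open>u\<close> and \<open>v\<close> is present iff
  \<open>(u, v)\<close> is an arc, equivalently iff \<open>(v, u)\<close> is. The vertex \<open>0\<close> is the sink.
\<close>

definition sink_graph :: "nat \<Rightarrow> nat pair_pre_digraph \<Rightarrow> bool" where
  "sink_graph n G \<longleftrightarrow>
     pair_graph G \<and> pverts G = {0} \<union> {1..n} \<and> (\<forall>i\<in>{1..n}. (0, i) \<in> parcs G)"

definition nbhd :: "nat \<Rightarrow> nat pair_pre_digraph \<Rightarrow> nat \<Rightarrow> nat set" where
  "nbhd n G i = {j \<in> {1..n}. (i, j) \<in> parcs G}"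

text \<open>This degree does not count the edge to the sink.\<close>

definition nonsink_degree :: "nat \<Rightarrow> nat pair_pre_digraph \<Rightarrow> nat \<Rightarrow> nat" where
  "nonsink_degree n G i = card (nbhd n G i)"

text \<open>
  Configurations are maps from \<open>{1..n}\<close> to the integers; they are taken extensional
  (\<open>undefined\<close> off \<open>{1..n}\<close>), so that HOL equality is equality as maps on \<open>{1..n}\<close>.
\<close>

definition chip_configs :: "nat \<Rightarrow> (nat \<Rightarrow> int) set" where
  "chip_configs n = {1..n} \<rightarrow>\<^sub>E UNIV"

definition nonneg_config :: "nat \<Rightarrow> (nat \<Rightarrow> int) \<Rightarrow> bool" where
  "nonneg_config n D \<longleftrightarrow> (\<forall>i\<in>{1..n}. 0 \<le> D i)"

definition fire ::
  "nat \<Rightarrow> nat \<Rightarrow> nat \<Rightarrow> nat \<Rightarrow> nat pair_pre_digraph \<Rightarrow> nat \<Rightarrow> (nat \<Rightarrow> int) \<Rightarrow> nat \<Rightarrow> int"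
where
  "fire a b c n G i D =
     (\<lambda>j\<in>{1..n}.
        if j = i then D j - (int c + \<lfloor>real (nonsink_degree n G i) * real a / real b\<rfloor>)
        else if j \<in> nbhd n G i then D j + \<lfloor>real a / real b\<rfloor>
        else D j)"

definition legal_fire ::
  "nat \<Rightarrow> nat \<Rightarrow> nat \<Rightarrow> nat \<Rightarrow> nat pair_pre_digraph \<Rightarrow> nat \<Rightarrow> (nat \<Rightarrow> int) \<Rightarrow> bool"
where
  "legal_fire a b c n G i D \<longleftrightarrow> nonneg_config n D \<and> nonneg_config n (fire a b c n G i D)"

definition legal_step ::
  "nat \<Rightarrow> nat \<Rightarrow> nat \<Rightarrow> nat \<Rightarrow> nat pair_pre_digraph \<Rightarrow> (nat \<Rightarrow> int) \<Rightarrow> (nat \<Rightarrow> int) \<Rightarrow> bool"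
where
  "legal_step a b c n G D D' \<longleftrightarrow>
     (\<exists>i\<in>{1..n}. legal_fire a b c n G i D \<and> D' = fire a b c n G i D)"

definition zero_stable ::
  "nat \<Rightarrow> nat \<Rightarrow> nat \<Rightarrow> nat \<Rightarrow> nat pair_pre_digraph \<Rightarrow> (nat \<Rightarrow> int) \<Rightarrow> bool"
where
  "zero_stable a b c n G D \<longleftrightarrow>
     D \<in> chip_configs n \<and> nonneg_config n D \<and> (\<forall>i\<in>{1..n}. \<not> legal_fire a b c n G i D)"

definition zero_stabilization ::
  "nat \<Rightarrow> nat \<Rightarrow> nat \<Rightarrow> nat \<Rightarrow> nat pair_pre_digraph \<Rightarrow> (nat \<Rightarrow> int) \<Rightarrow> (nat \<Rightarrow> int) \<Rightarrow> bool"
where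
  "zero_stabilization a b c n G D D' \<longleftrightarrow>
     zero_stable a b c n G D' \<and> (legal_step a b c n G)\<^sup>*\<^sup>* D D'"

end

theory Submission
  imports Defs "HOL-Library.Confluence"
begin

text \<open>
  Every firing removes at least \<open>c > 0\<close> chips in total, so stabilization terminates. Firing a vertex
  lowers only its own chip count, so two vertices that are both legal to fire may be fired in
  either order, with the same result; hence legal steps are confluent, and the final configuration
  is unique.
\<close>

lemma fire_in_chip_configs: "fire a b c n G i D \<in> chip_configs n"
  by (simp add: fire_def chip_configs_def)

lemma le_fire:
  assumes "j \<in> {1..n}" "j \<noteq> i"
  shows "D j \<le> fire a b c n G i D j"
  using assms by (simp add: fire_def)

text \<open>Since \<open>\<lfloor>real a / real b\<rfloor>\<close> is nonnegative, \<open>i\<close>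
  is the only vertex that can go negative when \<open>i\<close> fires. Legality thus becomes a fixed
  threshold on \<open>D i\<close>.\<close>

lemma legal_fire_iff:
  assumes "i \<in> {1..n}"
  shows "legal_fire a b c n G i D \<longleftrightarrow>
    nonneg_config n D \<and> int c + \<lfloor>real (nonsink_degree n G i) * real a / real b\<rfloor> \<le> D i"
proof
  assume "legal_fire a b c n G i D"
  then have "nonneg_config n D" "0 \<le> fire a b c n G i D i"
    using assms by (auto simp: legal_fire_def nonneg_config_def)
  then show "nonneg_config n D \<and> int c + \<lfloor>real (nonsink_degree n G i) * real a / real b\<rfloor> \<le> D i"
    using assms by (simp add: fire_def)
next
  assume *: "nonneg_config n D \<and> int c + \<lfloor>real (nonsink_degree n G i) * real a / real b\<rfloor> \<le> D i"
  have "0 \<le> fire a b c n G i D j" if "j \<in> {1..n}" for j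
  proof (cases "j = i")
    case True
    then show ?thesis using * assms by (simp add: fire_def)
  next
    case False
    then show ?thesis
      using * that le_fire[OF that False, of D a b c G] by (force simp: nonneg_config_def)
  qed
  then show "legal_fire a b c n G i D"
    using * by (simp add: legal_fire_def nonneg_config_def)
qed

text \<open>The amounts that a firing adds and subtracts do not depend on the configuration.\<close>

lemma fire_commute:
  "fire a b c n G i (fire a b c n G j D) = fire a b c n G j (fire a b c n G i D)"
  by (rule ext) (simp add: fire_def restrict_def)

text \<open>Firing \<open>j\<close> cannot lower the count at \<open>i\<close>, so \<open>i\<close>
  stays above its threshold.\<close>

lemma legal_fire_fire:
  assumes "i \<in> {1..n}" "i \<noteq> j" "legal_fire a b c n G i D" "legal_fire a b c n G j D"
  shows "legal_fire a b c n G i (fire a b c n G j D)"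
proof -
  have "nonneg_config n (fire a b c n G j D)"
    using assms(4) by (simp add: legal_fire_def)
  then show ?thesis
    using assms(3) le_fire[OF assms(1,2), of D a b c G]
    by (simp add: legal_fire_iff[OF assms(1)])
qed

lemma strong_confluentp_legal_step: "strong_confluentp (legal_step a b c n G)"
proof (rule strong_confluentpI)
  fix D E F
  assume "legal_step a b c n G D E" "legal_step a b c n G D F"
  then obtain i j where i: "i \<in> {1..n}" "legal_fire a b c n G i D" "E = fire a b c n G i D"
    and j: "j \<in> {1..n}" "legal_fire a b c n G j D" "F = fire a b c n G j D"
    unfolding legal_step_def by blast
  show "\<exists>H. (legal_step a b c n G)\<^sup>*\<^sup>* E H \<and> (legal_step a b c n G)\<^sup>=\<^sup>= F H"
  proof (cases "i = j")
    case True
    then show ?thesis using i j by auto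
  next
    case False
    \<comment> \<open>The common successor of \<open>E\<close> and \<open>F\<close> has both
      \<open>i\<close> and \<open>j\<close> fired; each side reaches it by the firing it has not yet
      made.\<close>
    have "legal_step a b c n G E (fire a b c n G j E)"
      using i j False legal_fire_fire unfolding legal_step_def by metis
    moreover have "legal_step a b c n G F (fire a b c n G j E)"
      using i j False legal_fire_fire fire_commute unfolding legal_step_def by metis
    ultimately show ?thesis by blast
  qed
qed

lemma of_nat_mult_floor_le:
  fixes x :: real
  shows "int k * \<lfloor>x\<rfloor> \<le> \<lfloor>real k * x\<rfloor>"
  by (simp add: le_floor_iff mult_left_mono)

text \<open>The neighbours receive \<open>deg * \<lfloor>a/b\<rfloor> \<le> \<lfloor>deg *
  a/b\<rfloor>\<close> chips in all, so the loss at \<open>i\<close> exceeds their gain by at least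
  \<open>c\<close>.\<close>

lemma sum_fire_le:
  assumes "i \<in> {1..n}"
  shows "(\<Sum>j\<in>{1..n}. fire a b c n G i D j) \<le> (\<Sum>j\<in>{1..n}. D j) - int c"
proof -
  let ?q = "\<lfloor>real a / real b\<rfloor>"
  let ?N = "nbhd n G i"
  let ?d = "\<lfloor>real (nonsink_degree n G i) * real a / real b\<rfloor>"
  \<comment> \<open>The bound is termwise: if \<open>i\<close> were in \<open>?N\<close>, the right
    side would count an extra \<open>?q \<ge> 0\<close> that \<open>fire\<close> does not
    add.\<close>
  have "(\<Sum>j\<in>{1..n}. fire a b c n G i D j) \<le>
      (\<Sum>j\<in>{1..n}. D j + (if j \<in> ?N then ?q else 0) - (if j = i then int c + ?d else 0))"
    by (rule sum_mono) (simp add: fire_def)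
  also have "\<dots> = (\<Sum>j\<in>{1..n}. D j) + (\<Sum>j\<in>{1..n}. if j \<in> ?N then ?q else 0) - (int c + ?d)"
    using assms by (simp add: sum.distrib sum_subtractf)
  also have "(\<Sum>j\<in>{1..n}. if j \<in> ?N then ?q else 0) = int (nonsink_degree n G i) * ?q"
  proof -
    have "{1..n} \<inter> ?N = ?N" by (auto simp: nbhd_def)
    then show ?thesis
      by (simp add: sum.If_cases nonsink_degree_def Int_def[symmetric])
  qed
  also have "\<dots> \<le> ?d"
    using of_nat_mult_floor_le[of "nonsink_degree n G i" "real a / real b"] by simp
  finally show ?thesis by simp
qed

lemma ex_zero_stabilization:
  assumes "0 < c" "D \<in> chip_configs n" "nonneg_config n D"
  shows "\<exists>D'. zero_stabilization a b c n G D D'"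
  using assms(2,3)
proof (induction D rule: measure_induct_rule[where f = "\<lambda>D. nat (\<Sum>j\<in>{1..n}. D j)"])
  case (less D)
  show ?case
  proof (cases "zero_stable a b c n G D")
    case True
    then show ?thesis by (auto simp: zero_stabilization_def)
  next
    case False
    then obtain i where i: "i \<in> {1..n}" "legal_fire a b c n G i D"
      using less.prems by (auto simp: zero_stable_def)
    let ?E = "fire a b c n G i D"
    have nonneg: "nonneg_config n ?E"
      using i(2) by (simp add: legal_fire_def)
    \<comment> \<open>This keeps the drop by \<open>c\<close> strict after \<open>nat\<close>
      truncates both sums at 0.\<close>
    then have "0 \<le> (\<Sum>j\<in>{1..n}. ?E j)"
      by (intro sum_nonneg) (simp add: nonneg_config_def)
    then have "nat (\<Sum>j\<in>{1..n}. ?E j) < nat (\<Sum>j\<in>{1..n}. D j)"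
      using sum_fire_le[OF i(1), of a b c G D] \<open>0 < c\<close> by linarith
    then obtain D' where "zero_stabilization a b c n G ?E D'"
      using less.IH nonneg fire_in_chip_configs by blast
    moreover have "legal_step a b c n G D ?E"
      using i by (auto simp: legal_step_def)
    ultimately show ?thesis
      by (auto simp: zero_stabilization_def intro: converse_rtranclp_into_rtranclp)
  qed
qed

text \<open>No legal step leaves a stable configuration, so the path from \<open>D\<close> is
  empty.\<close>

lemma zero_stable_rtranclp_eq:
  assumes "zero_stable a b c n G D" "(legal_step a b c n G)\<^sup>*\<^sup>* D E"
  shows "E = D"
  using assms(2,1) by (cases rule: converse_rtranclpE) (auto simp: zero_stable_def legal_step_def)

lemma zero_stabilization_unique:
  assumes "zero_stabilization a b c n G D E" "zero_stabilization a b c n G D F"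
  shows "E = F"
proof -
  have "confluentp (legal_step a b c n G)"
    by (rule strong_confluentp_imp_confluentp) (rule strong_confluentp_legal_step)
  \<comment> \<open>As \<open>E\<close> and \<open>F\<close> are both stable, each must equal the
    common reduct \<open>H\<close>.\<close>
  then obtain H where "(legal_step a b c n G)\<^sup>*\<^sup>* E H" "(legal_step a b c n G)\<^sup>*\<^sup>* F H"
    using assms unfolding zero_stabilization_def by (blast dest: confluentpD)
  then show ?thesis
    using assms zero_stable_rtranclp_eq unfolding zero_stabilization_def by metis
qed

theorem theorem2p7:
  fixes a b c n :: nat and G :: "nat pair_pre_digraph" and D :: "nat \<Rightarrow> int"
  assumes "0 < a" and "0 < b" and "0 < c"
    and "sink_graph n G"
    and "D \<in> chip_configs n" and "nonneg_config n D"
  shows "\<exists>!D'. zero_stabilization a b c n G D D'"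
  using ex_zero_stabilization[OF assms(3,5,6)] zero_stabilization_unique by blast

end
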